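(* Let $n\geq 2$ and $d\geq 2$. Define linear maps on operators on $(\mathbb{C}^d)^{\otimes n}$ by $$\phi=\sum_A\Lambda_A\otimes I_{\bar A},\qquad \mu[\rho]=\phi[\rho]+(2^{n-1}-2)\Big(\mathrm{Diag}[\phi[\rho]]-\sum_A\mathrm{Diag}[\rho]\Big),$$ where both sums run over the $2^{n-1}-1$ bipartitions $A|\bar A$ of $\{1,\dots,n\}$ and $\Lambda_A$ is the $d$-dimensional Choi map applied to the subsystems contained in $A$ (see context), and let $\mathcal{X}_n^d$ be the mixture of local unitaries defined in the context. Then $\mu\circ\mathcal{X}_n^d[\rho]\geq 0$ for every $n$-partite biseparable state $\rho$ on $(\mathbb{C}^d)^{\otimes n}$.
   Context: Choi map: the Choi map of dimension $d$ is the linear map on $d\times d$ matrices $\Lambda[\rho]=2\,\mathrm{Diag}[\rho]+\sum_{j=1}^{d-2}X_d^{\,j}\,\mathrm{Diag}[\rho]\,(X_d^{\,j})^\dagger-\rho$, where $\mathrm{Diag}[\rho]$ is the diagonal matrix with the same diagonal entries as $\rho$ in the computational basis and $X_d$ is the cyclic shift matrix, $X_d|k\rangle=|k-1 \bmod d\rangle$ (the sum is empty for $d=2$). $\Lambda_A$ denotes this map applied to the subsystems contained in $A$, with the $d$-dimensional shift acting simultaneously on all of them: for an operator $Y$ on $(\mathbb{C}^d)^{\otimes |A|}$, $$\Lambda_A[Y]=2\,\mathrm{Diag}[Y]+\sum_{j=1}^{d-2}(X_d^{\otimes |A|})^{j}\,\mathrm{Diag}[Y]\,\big((X_d^{\otimes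 |A|})^{j}\big)^\dagger-Y,$$ where $\mathrm{Diag}[Y]$ is the diagonal part of $Y$ in the computational product basis of the subsystems in $A$; for $|A|=1$ this is $\Lambda$. $I_{\bar A}$ is the identity map on operators on the complementary subsystems. The sums over $A$ are over all partitions of $\{1,\dots,n\}$ into two non-empty parts $\{A,\bar A\}$, each bipartition counted once, with one (arbitrarily chosen and fixed) of its two parts called $A$. $\mathrm{Diag}$ in the definition of $\mu$ is taken in the computational basis of $(\mathbb{C}^d)^{\otimes n}$. Projection: let $Z_k=\mathrm{diag}(1,e^{2\pi ik/d},e^{2\pi i 2k/d},\dots,e^{2\pi i(d-1)k/d})$ for $k\in\{0,\dots,d-1\}$ and let $Z_k^j$ be $Z_k$ acting on the $j$-th tensor factor and as identity on the others. Set $h_{n,j}^d(\rho)=\frac1d\sum_{k=0}^{d-1}Z_k^1(Z_k^j)^\dagger\,\rho\,(Z_k^1)^\dagger Z_k^j$ and $\mathcal{X}_n^d=h_{n,2}^d\circ h_{n,3}^d\circ\cdots\circ h_{n,n}^d$. "$\geq 0$" means positive semidefinite. A state is a positive semidefinite operator of trace one; an $n$-partite state is biseparable if it is a finite convex combination of states, each of which is a product state $\rho_A\otimes\rho_{\bar A}$ with respect to some bipartition $A|\bar A$ of $\{1,\dots,n\}$ into two non-empty parts (different terms may use different bipartitions). *)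

theory Defs
  imports Complex_Main "HOL-Library.FuncSet" "HOL-Library.Disjoint_Sets" "HOL-Library.Nonpos_Ints"
begin

text \<open>
  An operator is given by its matrix in a fixed basis, as a function of row and column label.
  The finite set of basis labels is passed explicitly wherever a sum over it is taken; entries
  at labels outside that set are never used. A single qudit has the labels \<open>{..<d}\<close>.  The space
  \<open>(\<complex>\<^sup>d)\<^bsup>\<otimes>S\<^esup>\<close> for a finite set \<open>S\<close> of sites has the labels \<open>S \<rightarrow>\<^sub>E {..<d}\<close>, one digit per
  site; the sites of the \<open>n\<close>-partite system are \<open>{1..n}\<close>.
\<close>

type_synonym 'i op = "'i \<Rightarrow> 'i \<Rightarrow> complex"
type_synonym label = "nat \<Rightarrow> nat"

definition op_one :: "'i op" where
  "op_one x y = (if x = y then 1 else 0)"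

definition op_mult :: "'i set \<Rightarrow> 'i op \<Rightarrow> 'i op \<Rightarrow> 'i op" where
  "op_mult B M N x y = (\<Sum>z\<in>B. M x z * N z y)"

primrec op_power :: "'i set \<Rightarrow> 'i op \<Rightarrow> nat \<Rightarrow> 'i op" where
  "op_power B M 0 = op_one"
| "op_power B M (Suc j) = op_mult B M (op_power B M j)"

definition adjoint :: "'i op \<Rightarrow> 'i op" where
  "adjoint M x y = cnj (M y x)"

definition op_trace :: "'i set \<Rightarrow> 'i op \<Rightarrow> complex" where
  "op_trace B M = (\<Sum>x\<in>B. M x x)"

definition diag_part :: "'i op \<Rightarrow> 'i op" where
  "diag_part M x y = (if x = y then M x y else 0)"

definition psd :: "'i set \<Rightarrow> 'i op \<Rightarrow> bool" where
  "psd B M \<longleftrightarrow>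
     (\<forall>v :: 'i \<Rightarrow> complex. (\<Sum>x\<in>B. \<Sum>y\<in>B. cnj (v x) * M x y * v y) \<in> \<real>\<^sub>\<ge>\<^sub>0)"

definition is_state :: "'i set \<Rightarrow> 'i op \<Rightarrow> bool" where
  "is_state B M \<longleftrightarrow> psd B M \<and> op_trace B M = 1"

definition basis :: "nat \<Rightarrow> nat set \<Rightarrow> label set" where
  "basis d S = (S \<rightarrow>\<^sub>E {..<d})"

definition tensor :: "nat set \<Rightarrow> nat set \<Rightarrow> label op \<Rightarrow> label op \<Rightarrow> label op" where
  "tensor A A' M N x y =
     M (restrict x A) (restrict y A) * N (restrict x A') (restrict y A')"

definition biseparable :: "nat \<Rightarrow> nat \<Rightarrow> label op \<Rightarrow> bool" where
  "biseparable n d \<rho> \<longleftrightarrow>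
     is_state (basis d {1..n}) \<rho> \<and>
     (\<exists>(m::nat) (p :: nat \<Rightarrow> real) (A :: nat \<Rightarrow> nat set) (\<sigma> :: nat \<Rightarrow> label op) (\<tau> :: nat \<Rightarrow> label op).
        (\<forall>i<m. 0 \<le> p i) \<and> (\<Sum>i<m. p i) = 1 \<and>
        (\<forall>i<m. A i \<noteq> {} \<and> A i \<subset> {1..n} \<and>
           is_state (basis d (A i)) (\<sigma> i) \<and> is_state (basis d ({1..n} - A i)) (\<tau> i)) \<and>
        (\<forall>x\<in>basis d {1..n}. \<forall>y\<in>basis d {1..n}.
           \<rho> x y = (\<Sum>i<m. complex_of_real (p i) * tensor (A i) ({1..n} - A i) (\<sigma> i) (\<tau> i) x y)))"

text \<open>The entry at row \<open>r\<close> and column \<open>k\<close> of the shift; \<open>k + d - 1\<close> is \<open>k - 1\<close> modulo \<open>d\<close>.\<close>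

definition shift :: "nat \<Rightarrow> nat op" where
  "shift d r k = (if r = (k + d - 1) mod d then 1 else 0)"

definition tensor_power :: "nat set \<Rightarrow> nat op \<Rightarrow> label op" where
  "tensor_power A M x y = (\<Prod>i\<in>A. M (x i) (y i))"

definition choi_map :: "nat \<Rightarrow> nat set \<Rightarrow> label op \<Rightarrow> label op" where
  "choi_map d A Y x y =
     2 * diag_part Y x y
     + (\<Sum>j\<in>{1..d-2}.
          let U = op_power (basis d A) (tensor_power A (shift d)) j
          in op_mult (basis d A) (op_mult (basis d A) U (diag_part Y)) (adjoint U) x y)
     - Y x y"

text \<open>
  \<open>T \<otimes> I\<close> for a linear map \<open>T\<close> on the operators on the sites \<open>A\<close>. Fixing the digits of row and
  column outside \<open>A\<close> selects a block of \<open>\<rho>\<close>, which is an operator on \<open>A\<close>; \<open>T\<close> is applied to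
  each block.
\<close>

definition tensor_id :: "nat set \<Rightarrow> (label op \<Rightarrow> label op) \<Rightarrow> label op \<Rightarrow> label op" where
  "tensor_id A T \<rho> x y =
     T (\<lambda>a b. \<rho> (override_on x a A) (override_on y b A)) (restrict x A) (restrict y A)"

definition bipartitions :: "nat \<Rightarrow> nat set set set" where
  "bipartitions n = {P. partition_on {1..n} P \<and> card P = 2}"

text \<open>The function \<open>c\<close> chooses the part called \<open>A\<close> of each bipartition.\<close>

definition phi_map :: "nat \<Rightarrow> nat \<Rightarrow> (nat set set \<Rightarrow> nat set) \<Rightarrow> label op \<Rightarrow> label op" where
  "phi_map n d c \<rho> x y = (\<Sum>P\<in>bipartitions n. tensor_id (c P) (choi_map d (c P)) \<rho> x y)"

definition mu_map :: "nat \<Rightarrow> nat \<Rightarrow> (nat set set \<Rightarrow> nat set) \<Rightarrow> label op \<Rightarrow> label op" where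
  "mu_map n d c \<rho> x y =
     phi_map n d c \<rho> x y
     + (2 ^ (n - 1) - 2) *
       (diag_part (phi_map n d c \<rho>) x y - (\<Sum>P\<in>bipartitions n. diag_part \<rho> x y))"

definition Z_op :: "nat \<Rightarrow> nat \<Rightarrow> nat op" where
  "Z_op d k r s =
     (if r = s then exp (2 * of_real pi * \<i> * of_nat r * of_nat k / of_nat d) else 0)"

definition at_site :: "nat \<Rightarrow> nat \<Rightarrow> nat op \<Rightarrow> label op" where
  "at_site n j M x y = M (x j) (y j) * (\<Prod>i\<in>{1..n} - {j}. op_one (x i) (y i))"

definition h_map :: "nat \<Rightarrow> nat \<Rightarrow> nat \<Rightarrow> label op \<Rightarrow> label op" where
  "h_map n d j \<rho> x y =
     1 / of_nat d *
     (\<Sum>k<d.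
        let mul = op_mult (basis d {1..n});
            Z1 = at_site n 1 (Z_op d k);
            Zj = at_site n j (Z_op d k)
        in mul (mul (mul (mul Z1 (adjoint Zj)) \<rho>) (adjoint Z1)) Zj x y)"

definition X_map :: "nat \<Rightarrow> nat \<Rightarrow> label op \<Rightarrow> label op" where
  "X_map n d = foldr (\<circ>) (map (h_map n d) [2..<n+1]) id"

end

theory Submission
  imports Defs "HOL-Analysis.Analysis"
begin

text \<open>
  The twirl keeps exactly the entries \<open>\<rho> x y\<close> for which \<open>x - y\<close> is a constant vector modulo \<open>d\<close>, so
  the twirled operator is block diagonal along the orbits of the diagonal rotation of labels. Two
  labels of one orbit that agree at one site are equal; hence every \<open>\<Lambda>\<^sub>A\<close> acts off the diagonal as
  \<open>- id\<close>, and with \<open>N\<close> bipartitions \<open>\<mu>\<close> has the off-diagonal entries \<open>- N * \<rho> x y\<close> and the diagonal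
  entries \<open>N * \<rho> x x + (2 ^ (n - 1) - 1) * S x\<close>, where \<open>S x\<close> sums, over all bipartitions, the diagonal
  entries of \<open>\<rho>\<close> at the labels rotated on \<open>A\<close> only.

  For a product across \<open>A\<close> the summand of \<open>S x\<close> that belongs to \<open>A\<close> suffices: on each orbit it turns
  the block into the Hadamard product of the Choi map of one factor with the other factor. The
  remaining terms are diagonal and nonnegative because \<open>N \<le> 2 ^ (n - 1) - 1\<close>. So positivity reduces
  to the Schur product theorem and to positivity of the single-system Choi map, that is, to the
  cyclic inequality \<open>\<Sum>s. p s / (P + p s - p (s - 1)) \<le> 1\<close> with \<open>P = \<Sum>s. p s\<close>.
\<close>

section \<open>Positive semidefinite matrices\<close>

definition qform :: "'i set \<Rightarrow> 'i op \<Rightarrow> ('i \<Rightarrow> complex) \<Rightarrow> complex" where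
  "qform B M v = (\<Sum>x\<in>B. \<Sum>y\<in>B. cnj (v x) * M x y * v y)"

lemma psd_iff_qform: "psd B M \<longleftrightarrow> (\<forall>v. qform B M v \<in> \<real>\<^sub>\<ge>\<^sub>0)"
  by (simp add: psd_def qform_def)

lemma nonneg_Reals_sum:
  fixes f :: "'a \<Rightarrow> complex"
  assumes "\<And>x. x \<in> A \<Longrightarrow> f x \<in> \<real>\<^sub>\<ge>\<^sub>0"
  shows "sum f A \<in> \<real>\<^sub>\<ge>\<^sub>0"
  using assms by (induction A rule: infinite_finite_induct) auto

lemma psd_cong:
  assumes "\<And>x y. x \<in> B \<Longrightarrow> y \<in> B \<Longrightarrow> M x y = N x y"
  shows "psd B M \<longleftrightarrow> psd B N"
  using assms by (simp add: psd_def cong: sum.cong)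

lemma psd_scale:
  assumes "psd B M" and "c \<in> \<real>\<^sub>\<ge>\<^sub>0"
  shows "psd B (\<lambda>x y. c * M x y)"
proof -
  have "qform B (\<lambda>x y. c * M x y) v = c * qform B M v" for v
    by (simp add: qform_def sum_distrib_left mult_ac)
  with assms show ?thesis
    by (simp add: psd_iff_qform)
qed

lemma psd_add:
  assumes "psd B M" and "psd B N"
  shows "psd B (\<lambda>x y. M x y + N x y)"
proof -
  have "qform B (\<lambda>x y. M x y + N x y) v = qform B M v + qform B N v" for v
    by (simp add: qform_def sum.distrib algebra_simps)
  with assms show ?thesis
    by (simp add: psd_iff_qform)
qed

lemma psd_sum:
  assumes "\<And>k. k \<in> K \<Longrightarrow> psd B (M k)"
  shows "psd B (\<lambda>x y. \<Sum>k\<in>K. M k x y)"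
proof -
  have "psd B (\<lambda>x y. 0)"
    by (simp add: psd_def)
  with assms show ?thesis
    by (induction K rule: infinite_finite_induct) (auto intro: psd_add)
qed

lemma psd_diagonal:
  assumes "finite B" and "\<And>x. x \<in> B \<Longrightarrow> h x \<in> \<real>\<^sub>\<ge>\<^sub>0"
  shows "psd B (\<lambda>x y. if x = y then h x else 0)"
proof -
  have "(\<Sum>y\<in>B. cnj (v x) * (if x = y then h x else 0) * v y) = h x * complex_of_real ((cmod (v x))\<^sup>2)"
    if "x \<in> B" for v x
  proof -
    have "(\<Sum>y\<in>B. cnj (v x) * (if x = y then h x else 0) * v y)
        = (\<Sum>y\<in>B. if x = y then cnj (v x) * h x * v y else 0)"
      by (rule sum.cong) auto
    also have "\<dots> = h x * (v x * cnj (v x))"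
      using that assms(1) by simp
    finally show ?thesis
      by (simp add: flip: complex_norm_square)
  qed
  then show ?thesis
    using assms(2)
    by (auto simp: psd_def intro!: nonneg_Reals_sum nonneg_Reals_mult_I simp del: of_real_power)
qed

text \<open>Extending test vectors by zero passes positivity on to principal submatrices.\<close>

lemma psd_subset:
  assumes "psd B M" and "finite B" and "B' \<subseteq> B"
  shows "psd B' M"
  unfolding psd_iff_qform
proof
  fix v :: "'a \<Rightarrow> complex"
  let ?v = "\<lambda>x. if x \<in> B' then v x else 0"
  have B': "B' = B \<inter> B'"
    using assms(3) by blast
  have "qform B M ?v = (\<Sum>x\<in>B. if x \<in> B' then \<Sum>y\<in>B. if y \<in> B' then cnj (v x) * M x y * v y else 0 else 0)"
    unfolding qform_def by (intro sum.cong) (auto intro!: sum.cong)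
  also have "\<dots> = qform B' M v"
    unfolding qform_def sum.inter_restrict[OF assms(2), symmetric] B'[symmetric] ..
  finally show "qform B' M v \<in> \<real>\<^sub>\<ge>\<^sub>0"
    using assms(1) by (metis psd_iff_qform)
qed

lemma psd_diag_nonneg:
  assumes "psd B M" and "finite B" and "x \<in> B"
  shows "M x x \<in> \<real>\<^sub>\<ge>\<^sub>0"
proof -
  have "psd {x} M"
    using assms by (auto intro: psd_subset)
  then have "qform {x} M (\<lambda>_. 1) \<in> \<real>\<^sub>\<ge>\<^sub>0"
    by (simp add: psd_iff_qform)
  then show ?thesis
    by (simp add: qform_def)
qed

text \<open>The form at the vector with entries \<open>1\<close> and \<open>q\<close>; suitable
  choices of \<open>q\<close> yield hermiticity and the vanishing of columns below a zero diagonal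
  entry.\<close>

lemma psd_two_points:
  assumes "psd B M" and "finite B" and "x \<in> B" and "y \<in> B" and "x \<noteq> y"
  shows "M x x + M x y * q + cnj q * M y x + cnj q * M y y * q \<in> \<real>\<^sub>\<ge>\<^sub>0"
proof -
  have "psd {x, y} M"
    using assms by (auto intro: psd_subset)
  then have "qform {x, y} M (\<lambda>z. if z = x then 1 else q) \<in> \<real>\<^sub>\<ge>\<^sub>0"
    by (simp add: psd_iff_qform)
  then show ?thesis
    using assms(5) by (simp add: qform_def add.assoc)
qed

lemma psd_hermitian:
  assumes "psd B M" and "finite B" and "x \<in> B" and "y \<in> B"
  shows "cnj (M x y) = M y x"
proof (cases "x = y")
  case True
  then show ?thesis
    using psd_diag_nonneg[OF assms(1-3)] by (auto simp: complex_nonneg_Reals_iff complex_eq_iff)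
next
  case False
  note two = psd_two_points[OF assms False]
  \<comment> \<open>\<open>q = 1\<close> makes the imaginary parts of \<open>M x y\<close> and
    \<open>M y x\<close> opposite, \<open>q = \<i>\<close> makes the real parts equal.\<close>
  show ?thesis
    using two[of 1] two[of \<i>] psd_diag_nonneg[OF assms(1,2,3)] psd_diag_nonneg[OF assms(1,2,4)]
    by (auto simp: complex_nonneg_Reals_iff complex_eq_iff)
qed

lemma psd_zero_diag:
  assumes "psd B M" and "finite B" and "x \<in> B" and "y \<in> B" and "M y y = 0"
  shows "M x y = 0"
proof (cases "x = y")
  case False
  define m where "m = Re (M x x)"
  define c where "c = (cmod (M x y))\<^sup>2"
  have herm: "M y x = cnj (M x y)"
    using psd_hermitian[OF assms(1-4)] by simp
  have "m - 2 * t * c \<ge> 0" for t :: real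
  proof -
    have "M x x - 2 * of_real t * (M x y * cnj (M x y)) \<in> \<real>\<^sub>\<ge>\<^sub>0"
      using psd_two_points[OF assms(1-4) False, of "- of_real t * cnj (M x y)"] assms(5)
      by (simp add: herm algebra_simps)
    then show ?thesis
      by (simp add: complex_nonneg_Reals_iff m_def c_def complex_mult_cnj cmod_power2 algebra_simps)
  qed
  \<comment> \<open>If \<open>c \<noteq> 0\<close>, the left-hand side equals \<open>-1\<close> at
    this \<open>t\<close>: an affine function with nonzero slope is not bounded below.\<close>
  from this[of "(m + 1) / (2 * c)"] have "c = 0"
    by (auto simp: divide_simps split: if_splits)
  then show ?thesis
    by (simp add: c_def)
qed (use assms(5) in simp)

section \<open>Gram decompositions and the Schur product theorem\<close>

lemma psd_gramI:
  assumes "finite K"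
    and "\<And>x y. x \<in> B \<Longrightarrow> y \<in> B \<Longrightarrow> M x y = (\<Sum>k\<in>K. v k x * cnj (v k y))"
  shows "psd B M"
proof -
  have "psd B (\<lambda>x y. v k x * cnj (v k y))" for k
  proof -
    have "qform B (\<lambda>x y. v k x * cnj (v k y)) w
        = of_real ((cmod (\<Sum>x\<in>B. cnj (w x) * v k x))\<^sup>2)" for w
      unfolding complex_norm_square
      unfolding qform_def cnj_sum sum_product by (intro sum.cong) (auto simp: mult_ac)
    then show ?thesis
      by (simp add: psd_iff_qform)
  qed
  then have "psd B (\<lambda>x y. \<Sum>k\<in>K. v k x * cnj (v k y))"
    by (rule psd_sum)
  with assms(2) show ?thesis
    by (subst psd_cong) auto
qed

text \<open>Cholesky: split off the rank-one matrix that matches the row and the column of one label;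
  the Schur complement that remains is positive semidefinite. If the diagonal entry \<open>m\<close> of that
  label vanishes, so do its row and column, and the junk value \<open>x / 0 = 0\<close> gives the right answer.\<close>

lemma psd_gram:
  assumes "finite B" and "psd B M"
  shows "\<exists>v. \<forall>x\<in>B. \<forall>y\<in>B. M x y = (\<Sum>k\<in>B. v k x * cnj (v k y))"
  using assms
proof (induction B arbitrary: M)
  case empty
  then show ?case by simp
next
  case (insert a B)
  let ?B = "insert a B"
  have fin: "finite ?B"
    using insert.hyps by simp
  note herm = psd_hermitian[OF insert.prems fin]
  define m where "m = Re (M a a)"
  have m: "M a a = of_real m" "m \<ge> 0"
    using psd_diag_nonneg[OF insert.prems fin, of a]
    by (auto simp: m_def complex_nonneg_Reals_iff complex_eq_iff)
  define M' where "M' = (\<lambda>x y. M x y - M x a * M a y / of_real m)"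
  have "psd B M'"
    unfolding psd_iff_qform
  proof
    fix w
    define s where "s = (\<Sum>y\<in>B. M a y * w y)"
    have s': "(\<Sum>x\<in>B. cnj (w x) * M x a) = cnj s"
      unfolding s_def cnj_sum by (intro sum.cong) (auto simp: herm mult_ac)
    \<comment> \<open>Completing the square: for \<open>m > 0\<close> this value at \<open>a\<close>
      minimises the form of \<open>M\<close>, and the minimum is the form of the Schur complement
      \<open>M'\<close>.\<close>
    define t where "t = - s / of_real m"
    define w' where "w' = w(a := t)"
    have w': "w' a = t" "\<And>x. x \<in> B \<Longrightarrow> w' x = w x"
      using insert.hyps by (auto simp: w'_def)
    have "qform ?B M w' = cnj t * M a a * t + cnj t * s + cnj s * t + qform B M w"
      using insert.hyps w'
      unfolding s'[symmetric]
      by (simp add: qform_def sum.distrib s_def sum_distrib_left sum_distrib_right mult.assoc)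
    also have "\<dots> = qform B M w - cnj s * s / of_real m"
      by (cases "m = 0") (simp_all add: t_def m field_simps)
    also have "\<dots> = qform B M' w"
    proof -
      have "cnj s * s = (\<Sum>x\<in>B. \<Sum>y\<in>B. cnj (w x) * (M x a * M a y) * w y)"
        unfolding s'[symmetric] unfolding s_def sum_product by (intro sum.cong) (auto simp: mult_ac)
      then show ?thesis
        by (simp add: qform_def M'_def sum_divide_distrib sum_subtractf algebra_simps)
    qed
    finally show "qform B M' w \<in> \<real>\<^sub>\<ge>\<^sub>0"
      using insert.prems by (metis psd_iff_qform)
  qed
  from insert.IH[OF this] obtain v where
    v: "\<And>x y. x \<in> B \<Longrightarrow> y \<in> B \<Longrightarrow> M' x y = (\<Sum>k\<in>B. v k x * cnj (v k y))"
    by blast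
  \<comment> \<open>The new Gram vector is the scaled column of \<open>a\<close>; the old ones are
    extended by zero at \<open>a\<close>, where the row and column of \<open>M'\<close>
    vanish.\<close>
  define u where "u = (\<lambda>k x. if k = a then M x a / of_real (sqrt m) else if x = a then 0 else v k x)"
  have M'_a: "M' x a = 0" "M' a x = 0" if "x \<in> ?B" for x
    using that psd_zero_diag[OF insert.prems fin that, of a] herm[of x a] m
    by (cases "m = 0"; simp add: M'_def)+
  have "M x y = (\<Sum>k\<in>?B. u k x * cnj (u k y))" if xy: "x \<in> ?B" "y \<in> ?B" for x y
  proof -
    have "(\<Sum>k\<in>B. u k x * cnj (u k y)) = M' x y"
    proof (cases "x = a \<or> y = a")
      case True
      then have "(\<Sum>k\<in>B. u k x * cnj (u k y)) = 0"
        using insert.hyps by (intro sum.neutral) (auto simp: u_def)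
      with True show ?thesis
        using M'_a xy by auto
    next
      case False
      then have "(\<Sum>k\<in>B. u k x * cnj (u k y)) = (\<Sum>k\<in>B. v k x * cnj (v k y))"
        using insert.hyps by (intro sum.cong) (auto simp: u_def)
      with False show ?thesis
        using v xy by auto
    qed
    moreover have "u a x * cnj (u a y) = M x a * M a y / of_real m"
      using herm[of y a] xy m(2) by (simp add: u_def flip: of_real_mult)
    ultimately show ?thesis
      using insert.hyps by (simp add: M'_def)
  qed
  then show ?case
    by blast
qed

text \<open>Gram vectors pulled back along \<open>g\<close> are Gram vectors of the new matrix, so
  repeated labels do no harm. It serves to restrict the factors of a product to one orbit.\<close>

lemma psd_compress:
  assumes "psd B M" and "finite B" and "g ` B' \<subseteq> B"
  shows "psd B' (\<lambda>x y. M (g x) (g y))"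
proof -
  obtain v where "\<forall>x\<in>B. \<forall>y\<in>B. M x y = (\<Sum>k\<in>B. v k x * cnj (v k y))"
    using psd_gram[OF assms(2,1)] by blast
  with assms(2,3) show ?thesis
    by (intro psd_gramI[where K = B and v = "\<lambda>k x. v k (g x)"]) auto
qed

text \<open>Schur product theorem: expand \<open>N\<close> into rank-one terms; multiplying
  \<open>M\<close> entrywise by one of them is a congruence of \<open>M\<close> by a diagonal
  matrix.\<close>

lemma psd_hadamard:
  assumes "psd B M" and "psd B N" and "finite B"
  shows "psd B (\<lambda>x y. M x y * N x y)"
proof -
  obtain v where v: "\<forall>x\<in>B. \<forall>y\<in>B. N x y = (\<Sum>k\<in>B. v k x * cnj (v k y))"
    using psd_gram[OF assms(3,2)] by blast
  have "psd B (\<lambda>x y. M x y * (v k x * cnj (v k y)))" for k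
  proof -
    have "qform B (\<lambda>x y. M x y * (v k x * cnj (v k y))) w = qform B M (\<lambda>x. w x * cnj (v k x))" for w
      by (simp add: qform_def mult_ac)
    with assms(1) show ?thesis
      by (simp add: psd_iff_qform)
  qed
  then have "psd B (\<lambda>x y. \<Sum>k\<in>B. M x y * (v k x * cnj (v k y)))"
    by (rule psd_sum)
  then show ?thesis
    by (rule psd_cong[THEN iffD1, rotated]) (simp add: v sum_distrib_left)
qed

section \<open>Positivity of the Choi map\<close>

lemma add_mod_cancel:
  fixes d :: nat
  shows "(x + t) mod d = (y + t) mod d \<longleftrightarrow> x mod d = y mod d"
proof
  assume "(x + t) mod d = (y + t) mod d"
  then have "(int x + int t) mod int d = (int y + int t) mod int d"
    by (metis of_nat_add zmod_int)
  then have "int d dvd int x - int y"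
    by (simp add: mod_eq_dvd_iff)
  then have "int x mod int d = int y mod int d"
    by (simp add: mod_eq_dvd_iff)
  then show "x mod d = y mod d"
    by (metis nat_int zmod_int)
qed (metis mod_add_left_eq)

lemma bij_betw_add_mod:
  fixes d :: nat
  assumes "d > 0"
  shows "bij_betw (\<lambda>s. (s + t) mod d) {..<d} {..<d}"
proof -
  have "inj_on (\<lambda>s. (s + t) mod d) {..<d}"
  proof (rule inj_onI)
    fix x y assume "x \<in> {..<d}" "y \<in> {..<d}" and "(x + t) mod d = (y + t) mod d"
    then have "x mod d = y mod d"
      by (simp add: add_mod_cancel)
    with \<open>x \<in> _\<close> \<open>y \<in> _\<close> show "x = y"
      by simp
  qed
  moreover have "(\<lambda>s. (s + t) mod d) ` {..<d} \<subseteq> {..<d}"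
    using assms by auto
  ultimately show ?thesis
    by (simp add: bij_betw_def endo_inj_surj)
qed

lemma sum_add_mod:
  fixes d :: nat
  assumes "d > 0"
  shows "(\<Sum>s<d. f ((s + t) mod d)) = (\<Sum>s<d. f s)"
  using sum.reindex_bij_betw[OF bij_betw_add_mod[OF assms], of f t] by simp

text \<open>The offsets \<open>1..d-2\<close> miss only \<open>0\<close> and \<open>d - 1\<close> in
  a full cycle, that is, \<open>s\<close> itself and its predecessor.\<close>

lemma choi_diag_sum:
  fixes f :: "nat \<Rightarrow> 'a::comm_ring_1" and d s :: nat
  assumes "d \<ge> 2" and "s < d"
  shows "2 * f s + (\<Sum>j\<in>{1..d-2}. f ((s + j) mod d)) = (\<Sum>t<d. f t) + f s - f ((s + d - 1) mod d)"
proof -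
  have "{..<d} = insert 0 (insert (d - 1) {1..d-2})"
    using assms(1) by auto
  moreover have "d - 1 \<notin> {1..d-2}" "0 \<notin> insert (d - 1) {1..d-2}"
    using assms(1) by auto
  ultimately have "(\<Sum>j<d. f ((s + j) mod d))
      = f (s mod d) + f ((s + (d - 1)) mod d) + (\<Sum>j\<in>{1..d-2}. f ((s + j) mod d))"
    using assms(1) by (simp del: One_nat_def)
  moreover have "(\<Sum>j<d. f ((s + j) mod d)) = (\<Sum>t<d. f t)"
    using sum_add_mod[of d f s] assms(1) by (simp add: add.commute)
  ultimately show ?thesis
    using assms by simp
qed

text \<open>The weights \<open>g\<close> in the proof come from the tangent line to \<open>1 / D\<close> at \<open>D = P\<close>, applied to
  \<open>1 - 2 * p s / D s = (P - p s - p' s) / D s\<close>, where \<open>p'\<close> is the cyclic predecessor of \<open>p\<close>.\<close>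

lemma choi_weights:
  fixes p :: "nat \<Rightarrow> real"
  assumes "d \<ge> 2" and pos: "\<And>s. s < d \<Longrightarrow> 0 \<le> p s"
  defines "D \<equiv> \<lambda>s. (\<Sum>t<d. p t) + p s - p ((s + d - 1) mod d)"
  obtains g where "\<And>s. s < d \<Longrightarrow> 0 \<le> g s" and "\<And>s. s < d \<Longrightarrow> p s \<le> g s * D s" and "(\<Sum>s<d. g s) = 1"
proof (cases "(\<Sum>t<d. p t) = 0")
  case True
  have "\<forall>s\<in>{..<d}. p s = 0"
    using True pos by (subst (asm) sum_nonneg_eq_0_iff) auto
  then have "p s = 0" if "s < d" for s
    using that by simp
  \<comment> \<open>All \<open>p s\<close> vanish here, so any nonnegative weights of total one will
    do.\<close>
  with assms(1) True show ?thesis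
    by (intro that[of "\<lambda>_. 1 / real d"]) (simp_all add: D_def)
next
  case False
  define P where "P = (\<Sum>t<d. p t)"
  have P: "P > 0"
    using False pos sum_nonneg[of "{..<d}" p] by (auto simp: P_def less_le)
  define p' where "p' = (\<lambda>s. p ((s + d - 1) mod d))"
  have p': "0 \<le> p' s" for s
    using assms(1) pos by (simp add: p'_def)
  have sum_p': "(\<Sum>s<d. f (p' s)) = (\<Sum>s<d. f (p s))" for f :: "real \<Rightarrow> real"
    using sum_add_mod[of d "\<lambda>s. f (p s)" "d - 1"] assms(1) by (simp add: p'_def)
  have le: "p s + p' s \<le> P" if "s < d" for s
  proof -
    \<comment> \<open>A step back on a cycle of length at least two never stays put, so
      \<open>p s\<close> and \<open>p' s\<close> are different terms of \<open>P\<close>.\<close>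
    have "s \<noteq> (s + d - 1) mod d"
    proof (cases "s = 0")
      case False
      then have "s + d - 1 = (s - 1) + d"
        by simp
      then show ?thesis
        using that False by (metis diff_less less_imp_diff_less less_numeral_extra(1) mod_add_self2 mod_less nat_neq_iff neq0_conv)
    qed (use assms(1) in simp)
    then have "p s + p' s = sum p {s, (s + d - 1) mod d}"
      by (simp add: p'_def)
    also have "\<dots> \<le> P"
      unfolding P_def using that assms(1) pos by (intro sum_mono2) auto
    finally show ?thesis .
  qed
  have D_eq: "D s = P + p s - p' s" for s
    by (simp add: D_def P_def p'_def)
  \<comment> \<open>Expanding the tangent bound leaves \<open>p s / P\<close> and a difference of
    squares that cancels in the cyclic sum.\<close>
  define g where "g = (\<lambda>s. p s / P + ((p' s)\<^sup>2 - (p s)\<^sup>2) / (2 * P\<^sup>2))"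
  have "0 \<le> g s" if "s < d" for s
  proof -
    have "g s = (P\<^sup>2 - (P - p s)\<^sup>2 + (p' s)\<^sup>2) / (2 * P\<^sup>2)"
      using P by (simp add: g_def field_simps power2_eq_square)
    moreover have "(P - p s)\<^sup>2 \<le> P\<^sup>2"
      using le[OF that] pos[OF that] p'[of s] by (intro power_mono) auto
    ultimately show ?thesis
      by simp
  qed
  moreover have "p s \<le> g s * D s" if "s < d" for s
  proof -
    have "g s * D s - p s = (P - p s - p' s) * (p s - p' s)\<^sup>2 / (2 * P\<^sup>2)"
      using P by (simp add: g_def D_eq field_simps power2_eq_square)
    moreover have "\<dots> \<ge> 0"
      using le[OF that] by simp
    ultimately show ?thesis
      by simp
  qed
  moreover have "(\<Sum>s<d. g s) = 1"
  proof -
    have "(\<Sum>s<d. g s) = P / P + ((\<Sum>s<d. (p' s)\<^sup>2) - (\<Sum>s<d. (p s)\<^sup>2)) / (2 * P\<^sup>2)"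
      unfolding g_def P_def
      by (simp only: sum.distrib sum_subtractf sum_divide_distrib diff_divide_distrib)
    then show ?thesis
      using P sum_p'[of "\<lambda>x. x\<^sup>2"] by simp
  qed
  ultimately show ?thesis
    by (rule that)
qed

text \<open>A nonnegative diagonal minus a rank-one matrix is positive if the squares
  \<open>|v s|^2\<close> divided by the diagonal sum to at most one. The weights \<open>g\<close>
  state this without division, so zero diagonal entries need no separate case.\<close>

lemma psd_choi_rank_one:
  fixes v :: "nat \<Rightarrow> complex"
  assumes "d \<ge> 2"
  defines "D \<equiv> \<lambda>s. (\<Sum>t<d. v t * cnj (v t)) + v s * cnj (v s)
    - v ((s + d - 1) mod d) * cnj (v ((s + d - 1) mod d))"
  shows "psd {..<d} (\<lambda>s t. (if s = t then D s else 0) - v s * cnj (v t))"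
  unfolding psd_iff_qform
proof
  fix w
  define E where "E = (\<lambda>s. (\<Sum>t<d. (cmod (v t))\<^sup>2) + (cmod (v s))\<^sup>2 - (cmod (v ((s + d - 1) mod d)))\<^sup>2)"
  have DE: "D s = of_real (E s)" for s
    by (simp only: D_def E_def of_real_add of_real_diff of_real_sum complex_norm_square)
  obtain g where g: "\<And>s. s < d \<Longrightarrow> 0 \<le> g s" "\<And>s. s < d \<Longrightarrow> (cmod (v s))\<^sup>2 \<le> g s * E s" "(\<Sum>s<d. g s) = 1"
    unfolding E_def using choi_weights[OF assms(1), of "\<lambda>s. (cmod (v s))\<^sup>2"] by auto
  have E: "E s \<ge> 0" if "s < d" for s
  proof -
    have "(cmod (v ((s + d - 1) mod d)))\<^sup>2 \<le> (\<Sum>t<d. (cmod (v t))\<^sup>2)"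
      using assms(1) by (intro member_le_sum) auto
    then show ?thesis
      unfolding E_def using zero_le_power2[of "cmod (v s)"] by linarith
  qed
  define S where "S = (\<Sum>s<d. cnj (w s) * v s)"
  have "cmod S \<le> (\<Sum>s<d. sqrt (g s) * (cmod (w s) * sqrt (E s)))"
    unfolding S_def
  proof (rule order_trans[OF norm_sum], rule sum_mono)
    fix s assume "s \<in> {..<d}"
    then have "cmod (v s) \<le> sqrt (g s * E s)"
      using g(2) by (simp add: real_le_rsqrt)
    then have "cmod (w s) * cmod (v s) \<le> cmod (w s) * sqrt (g s * E s)"
      by (rule mult_left_mono) simp
    then show "norm (cnj (w s) * v s) \<le> sqrt (g s) * (cmod (w s) * sqrt (E s))"
      by (simp add: norm_mult real_sqrt_mult mult_ac)
  qed
  then have "(cmod S)\<^sup>2 \<le> (\<Sum>s<d. sqrt (g s) * (cmod (w s) * sqrt (E s)))\<^sup>2"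
    by (rule power_mono) simp
  \<comment> \<open>The first factor is the total weight, which is one.\<close>
  also have "\<dots> \<le> (\<Sum>s<d. (sqrt (g s))\<^sup>2) * (\<Sum>s<d. (cmod (w s) * sqrt (E s))\<^sup>2)"
    by (rule Cauchy_Schwarz_ineq_sum)
  also have "\<dots> = (\<Sum>s<d. (cmod (w s))\<^sup>2 * E s)"
    using g(1,3) E by (simp add: power_mult_distrib)
  finally have le: "(cmod S)\<^sup>2 \<le> (\<Sum>s<d. (cmod (w s))\<^sup>2 * E s)" .
  have "qform {..<d} (\<lambda>s t. (if s = t then D s else 0) - v s * cnj (v t)) w
      = (\<Sum>s<d. \<Sum>t<d. (if s = t then cnj (w s) * D s * w t else 0)) -
        (\<Sum>s<d. \<Sum>t<d. (cnj (w s) * v s) * cnj (cnj (w t) * v t))"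
    unfolding qform_def sum_subtractf[symmetric]
    by (intro sum.cong) (auto simp: algebra_simps)
  also have "(\<Sum>s<d. \<Sum>t<d. (cnj (w s) * v s) * cnj (cnj (w t) * v t)) = S * cnj S"
    unfolding S_def cnj_sum sum_product ..
  also have "\<dots> = of_real ((cmod S)\<^sup>2)"
    by (rule complex_norm_square[symmetric])
  also have "(\<Sum>s<d. \<Sum>t<d. (if s = t then cnj (w s) * D s * w t else 0))
      = (\<Sum>s<d. (w s * cnj (w s)) * of_real (E s))"
    by (simp add: DE mult_ac)
  also have "\<dots> = of_real (\<Sum>s<d. (cmod (w s))\<^sup>2 * E s)"
    by (simp only: of_real_sum of_real_mult complex_norm_square)
  finally show "qform {..<d} (\<lambda>s t. (if s = t then D s else 0) - v s * cnj (v t)) w \<in> \<real>\<^sub>\<ge>\<^sub>0"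
    using le by (simp only: of_real_diff[symmetric] nonneg_Reals_of_real_iff diff_ge_0_iff_ge)
qed

text \<open>The Choi map is linear, so a Gram decomposition of \<open>M\<close> reduces its
  positivity to rank one.\<close>

lemma psd_choi:
  fixes d :: nat
  assumes "d \<ge> 2" and "psd {..<d} M"
  shows "psd {..<d} (\<lambda>s t. (if s = t then 2 * M s s + (\<Sum>j\<in>{1..d-2}. M ((s + j) mod d) ((s + j) mod d)) else 0)
    - M s t)"
proof -
  obtain v where v: "\<And>s t. s < d \<Longrightarrow> t < d \<Longrightarrow> M s t = (\<Sum>k<d. v k s * cnj (v k t))"
    using psd_gram[OF finite_lessThan assms(2)] by (auto simp: Ball_def)
  let ?D = "\<lambda>k s. (\<Sum>t<d. v k t * cnj (v k t)) + v k s * cnj (v k s)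
    - v k ((s + d - 1) mod d) * cnj (v k ((s + d - 1) mod d))"
  have "psd {..<d} (\<lambda>s t. \<Sum>k<d. (if s = t then ?D k s else 0) - v k s * cnj (v k t))"
    using assms(1) by (intro psd_sum psd_choi_rank_one)
  then show ?thesis
  proof (rule psd_cong[THEN iffD1, rotated])
    fix s t assume "s \<in> {..<d}" "t \<in> {..<d}"
    then have s: "s < d" "t < d"
      by auto
    have "(\<Sum>k<d. ?D k s) = (\<Sum>t<d. M t t) + M s s - M ((s + d - 1) mod d) ((s + d - 1) mod d)"
    proof -
      have "(\<Sum>k<d. \<Sum>t<d. v k t * cnj (v k t)) = (\<Sum>t<d. M t t)"
        by (subst sum.swap) (simp add: v)
      then show ?thesis
        using s assms(1) by (simp add: v sum.distrib sum_subtractf)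
    qed
    then have sum_D: "(\<Sum>k<d. ?D k s) = 2 * M s s + (\<Sum>j\<in>{1..d-2}. M ((s + j) mod d) ((s + j) mod d))"
      using choi_diag_sum[OF assms(1) s(1), of "\<lambda>s. M s s"] by simp
    have "(\<Sum>k<d. (if s = t then ?D k s else 0) - v k s * cnj (v k t))
        = (if s = t then \<Sum>k<d. ?D k s else 0) - M s t"
      using v[OF s] by (cases "s = t") (simp_all add: sum_subtractf sum.distrib sum_negf)
    then show "(\<Sum>k<d. (if s = t then ?D k s else 0) - v k s * cnj (v k t)) =
        (if s = t then 2 * M s s + (\<Sum>j\<in>{1..d-2}. M ((s + j) mod d) ((s + j) mod d)) else 0) - M s t"
      by (simp only: sum_D)
  qed
qed

section \<open>Entries of the maps\<close>

definition rot :: "nat \<Rightarrow> nat set \<Rightarrow> nat \<Rightarrow> label \<Rightarrow> label" where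
  "rot d A s x = (\<lambda>i. if i \<in> A then (x i + s) mod d else x i)"

lemma finite_basis: "finite S \<Longrightarrow> finite (basis d S)"
  by (simp add: basis_def finite_PiE)

lemma basis_less: "x \<in> basis d S \<Longrightarrow> i \<in> S \<Longrightarrow> x i < d"
  by (auto simp: basis_def)

lemma basis_eqI:
  "x \<in> basis d S \<Longrightarrow> y \<in> basis d S \<Longrightarrow> (\<And>i. i \<in> S \<Longrightarrow> x i = y i) \<Longrightarrow> x = y"
  by (metis basis_def PiE_ext)

lemma restrict_in_basis: "x \<in> basis d S \<Longrightarrow> A \<subseteq> S \<Longrightarrow> restrict x A \<in> basis d A"
  by (auto simp: basis_def)

lemma rot_in_basis: "x \<in> basis d S \<Longrightarrow> A \<subseteq> S \<Longrightarrow> d > 0 \<Longrightarrow> rot d A s x \<in> basis d S"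
  by (auto simp: basis_def rot_def PiE_iff extensional_def)

lemma rot_rot: "rot d A s (rot d A t x) = rot d A (t + s) x"
  by (auto simp: rot_def mod_add_left_eq add.assoc)

lemma rot_mod: "rot d A (s mod d) x = rot d A s x"
  by (auto simp: rot_def mod_add_right_eq)

lemma rot_0: "x \<in> basis d S \<Longrightarrow> A \<subseteq> S \<Longrightarrow> rot d A 0 x = x"
  by (auto simp: rot_def fun_eq_iff subset_iff dest: basis_less)

lemma rot_eq_iff:
  assumes "x \<in> basis d S" and "y \<in> basis d S" and "A \<subseteq> S"
  shows "rot d A s x = rot d A s y \<longleftrightarrow> x = y"
proof
  assume eq: "rot d A s x = rot d A s y"
  show "x = y"
  proof (rule basis_eqI[OF assms(1,2)])
    fix i assume "i \<in> S"
    then have "x i < d" "y i < d"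
      using assms by (auto intro: basis_less)
    with fun_cong[OF eq, of i] show "x i = y i"
      by (auto simp: rot_def add_mod_cancel split: if_splits)
  qed
qed simp

lemma bij_betw_rot:
  assumes "finite S" and "A \<subseteq> S" and "d > 0"
  shows "bij_betw (rot d A s) (basis d S) (basis d S)"
proof -
  have "inj_on (rot d A s) (basis d S)"
    by (rule inj_onI) (simp add: rot_eq_iff[OF _ _ assms(2)])
  moreover have "rot d A s ` basis d S \<subseteq> basis d S"
    using assms by (auto intro: rot_in_basis)
  ultimately show ?thesis
    using finite_basis[OF assms(1)] by (simp add: bij_betw_def endo_inj_surj)
qed

text \<open>Solving \<open>r = k - 1\<close> for the column: conjugation by the shift reads entries
  at labels rotated forward.\<close>

lemma shift_eq:
  assumes "r < d" and "k < d"
  shows "shift d r k = (if k = (r + 1) mod d then 1 else 0)"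
proof -
  have "r = (k + d - 1) mod d \<longleftrightarrow> (r + 1) mod d = ((k + d - 1) + 1) mod d"
    using assms(1) add_mod_cancel[of r 1 d "k + d - 1"] by (metis mod_less)
  also have "((k + d - 1) + 1) mod d = k"
    using assms by simp
  finally show ?thesis
    by (auto simp: shift_def)
qed

lemma prod_indicator:
  assumes "finite A"
  shows "(\<Prod>i\<in>A. if P i then 1 else (0::'a::comm_semiring_1)) = (if \<forall>i\<in>A. P i then 1 else 0)"
  using assms by (induction A) auto

lemma tensor_power_shift:
  assumes "finite A" and "a \<in> basis d A" and "b \<in> basis d A"
  shows "tensor_power A (shift d) a b = (if b = rot d A 1 a then 1 else 0)"
proof -
  have "tensor_power A (shift d) a b = (\<Prod>i\<in>A. if b i = (a i + 1) mod d then 1 else 0)"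
    using assms by (auto simp: tensor_power_def shift_eq basis_less intro!: prod.cong)
  also have "\<dots> = (if \<forall>i\<in>A. b i = (a i + 1) mod d then 1 else 0)"
    using assms(1) by (rule prod_indicator)
  also have "(\<forall>i\<in>A. b i = (a i + 1) mod d) \<longleftrightarrow> b = rot d A 1 a"
    using assms by (auto simp: rot_def basis_def PiE_iff extensional_def fun_eq_iff)
  finally show ?thesis .
qed

lemma op_power_shift:
  assumes "finite A" and "d > 0" and "a \<in> basis d A" and "b \<in> basis d A"
  shows "op_power (basis d A) (tensor_power A (shift d)) j a b = (if b = rot d A j a then 1 else 0)"
  using assms(3,4)
\<comment> \<open>\<open>op_power\<close> multiplies by the base on the left, so the remaining power
  is met at the rotated row.\<close>
proof (induction j arbitrary: a)
  case 0
  then show ?case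
    by (auto simp: op_one_def rot_0[OF _ order_refl])
next
  case (Suc j)
  have "op_power (basis d A) (tensor_power A (shift d)) (Suc j) a b
      = (\<Sum>z\<in>basis d A. if z = rot d A 1 a then if b = rot d A j z then 1 else 0 else 0)"
    using Suc assms(1) by (auto simp: op_mult_def tensor_power_shift intro!: sum.cong)
  also have "\<dots> = (if b = rot d A j (rot d A 1 a) then 1 else 0)"
    using Suc.prems assms(1,2) by (simp add: finite_basis rot_in_basis)
  finally show ?case
    by (simp add: rot_rot)
qed

lemma choi_map_eq:
  assumes "finite A" and "d > 0" and "a \<in> basis d A" and "b \<in> basis d A"
  shows "choi_map d A Y a b =
    (if a = b then 2 * Y a a + (\<Sum>j\<in>{1..d-2}. Y (rot d A j a) (rot d A j a)) else 0) - Y a b"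
proof -
  let ?B = "basis d A"
  have fin: "finite ?B"
    using assms(1) by (rule finite_basis)
  have "op_mult ?B (op_mult ?B U (diag_part Y)) (Defs.adjoint U) a b
      = (if a = b then Y (rot d A j a) (rot d A j a) else 0)"
    if "U = op_power ?B (tensor_power A (shift d)) j" for U j
  proof -
    let ?r = "rot d A j"
    have U: "U x y = (if y = ?r x then 1 else 0)" if "x \<in> ?B" "y \<in> ?B" for x y
      using that assms \<open>U = _\<close> by (simp add: op_power_shift)
    have r: "?r a \<in> ?B" "?r b \<in> ?B"
      using assms by (auto intro: rot_in_basis)
    have "op_mult ?B U (diag_part Y) a z = diag_part Y (?r a) z" for z
    proof -
      have "op_mult ?B U (diag_part Y) a z = (\<Sum>w\<in>?B. if w = ?r a then diag_part Y w z else 0)"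
        using assms unfolding op_mult_def by (intro sum.cong) (auto simp: U)
      then show ?thesis
        using fin r by simp
    qed
    then have "op_mult ?B (op_mult ?B U (diag_part Y)) (Defs.adjoint U) a b
        = (\<Sum>z\<in>?B. if z = ?r b then diag_part Y (?r a) z else 0)"
      using assms by (subst op_mult_def, intro sum.cong) (auto simp: U Defs.adjoint_def)
    also have "\<dots> = diag_part Y (?r a) (?r b)"
      using fin r by simp
    finally show ?thesis
      by (simp add: diag_part_def rot_eq_iff[OF assms(3,4) order_refl])
  qed
  then show ?thesis
    by (auto simp: choi_map_def diag_part_def Let_def)
qed

text \<open>A diagonal entry of a block only requires agreement on \<open>A\<close>; the digits
  outside \<open>A\<close> may still differ, so \<open>Diag\<close> on \<open>A\<close> also keeps
  some entries with \<open>x \<noteq> y\<close>.\<close>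

lemma tensor_id_choi_map:
  assumes "finite S" and "A \<subseteq> S" and "d > 0" and x: "x \<in> basis d S" and y: "y \<in> basis d S"
  shows "tensor_id A (choi_map d A) \<rho> x y =
    (if \<forall>i\<in>A. x i = y i
     then 2 * \<rho> x y + (\<Sum>j\<in>{1..d-2}. \<rho> (rot d A j x) (rot d A j y)) else 0) - \<rho> x y"
proof -
  have eq: "restrict x A = restrict y A \<longleftrightarrow> (\<forall>i\<in>A. x i = y i)"
    by (auto simp: restrict_def fun_eq_iff)
  have ov: "override_on z (restrict z A) A = z" for z :: label
    by (auto simp: override_on_def fun_eq_iff)
  have ov': "override_on z (rot d A j (restrict z A)) A = rot d A j z" for z :: label and j
    by (auto simp: override_on_def rot_def fun_eq_iff)
  have fA: "finite A"
    using assms by (auto intro: finite_subset)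
  note choi = choi_map_eq[OF fA assms(3) restrict_in_basis[OF x assms(2)] restrict_in_basis[OF y assms(2)]]
  show ?thesis
  proof (cases "\<forall>i\<in>A. x i = y i")
    case True
    then have "restrict x A = restrict y A"
      by (simp only: eq)
    then have "override_on y (restrict x A) A = y"
      and "override_on y (rot d A j (restrict x A)) A = rot d A j y" for j
      by (simp_all only: ov ov')
    with True show ?thesis
      by (simp only: tensor_id_def choi eq ov ov' if_True simp_thms)
  next
    case False
    then show ?thesis
      by (simp only: tensor_id_def choi eq ov if_False)
  qed
qed

section \<open>The twirl in coordinates\<close>

lemma sum_root_of_unity:
  fixes d :: nat and m :: int
  assumes "d > 0"
  shows "(\<Sum>k<d. exp (2 * of_real pi * \<i> * of_int m * of_nat k / of_nat d))
    = (if int d dvd m then of_nat d else 0)"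
proof -
  \<comment> \<open>A \<open>d\<close>-th root of unity: its powers form a geometric sum that
    vanishes unless \<open>z = 1\<close>.\<close>
  define z where "z = exp (2 * of_real pi * \<i> * of_int m / of_nat d)"
  have pow: "exp (2 * of_real pi * \<i> * of_int m * of_nat k / of_nat d) = z ^ k" for k
    by (simp add: z_def mult_ac flip: exp_of_nat_mult)
  have "z = 1 \<longleftrightarrow> (\<exists>n::int. 2 * pi * of_int m / of_nat d = of_int (2 * n) * pi)"
    by (simp add: z_def exp_eq_1)
  also have "\<dots> \<longleftrightarrow> (\<exists>n::int. real_of_int m = of_int (int d * n))"
    using assms by (intro ex_cong1) (auto simp: field_simps)
  also have "\<dots> \<longleftrightarrow> int d dvd m"
    by (simp only: of_int_eq_iff dvd_def)
  finally have z1: "z = 1 \<longleftrightarrow> int d dvd m" .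
  have "z ^ d = exp (2 * of_real pi * \<i> * of_int m)"
    using assms by (simp flip: pow)
  also have "\<dots> = 1"
    by (auto simp: exp_eq_1)
  finally have zd: "z ^ d = 1" .
  show ?thesis
  proof (cases "z = 1")
    case True
    then show ?thesis
      using z1 by (simp add: pow)
  next
    case False
    then show ?thesis
      using z1 zd by (simp add: pow geometric_sum)
  qed
qed

lemma op_mult_diagonal_left:
  assumes "finite B" and "x \<in> B" and "\<And>z. z \<in> B \<Longrightarrow> D x z = (if z = x then f else 0)"
  shows "op_mult B D M x y = f * M x y"
proof -
  have "op_mult B D M x y = (\<Sum>z\<in>B. if z = x then f * M z y else 0)"
    unfolding op_mult_def using assms(3) by (intro sum.cong) auto
  with assms(1,2) show ?thesis
    by simp
qed

lemma op_mult_diagonal_right: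
  assumes "finite B" and "y \<in> B" and "\<And>z. z \<in> B \<Longrightarrow> D z y = (if z = y then f else 0)"
  shows "op_mult B M D x y = M x y * f"
proof -
  have "op_mult B M D x y = (\<Sum>z\<in>B. if z = y then M x z * f else 0)"
    unfolding op_mult_def using assms(3) by (intro sum.cong) auto
  with assms(1,2) show ?thesis
    by simp
qed

lemma at_site_Z_op:
  assumes "j \<in> {1..n}" and "x \<in> basis d {1..n}" and "y \<in> basis d {1..n}"
  shows "at_site n j (Z_op d k) x y
    = (if y = x then exp (2 * of_real pi * \<i> * of_nat (x j) * of_nat k / of_nat d) else 0)"
proof (cases "y = x")
  case False
  then obtain i where i: "i \<in> {1..n}" "x i \<noteq> y i"
    using basis_eqI[OF assms(2,3)] by metis
  then show ?thesis
    using False by (cases "i = j") (auto simp: at_site_def Z_op_def op_one_def intro!: prod_zero)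
qed (simp add: at_site_def Z_op_def op_one_def)

text \<open>All four unitaries are diagonal, so each summand multiplies the entry by a phase;
  averaging over \<open>k\<close> keeps the entry exactly when \<open>d\<close> divides the phase
  exponent.\<close>

lemma h_map_eq:
  assumes "d > 0" and j: "j \<in> {1..n}" and x: "x \<in> basis d {1..n}" and y: "y \<in> basis d {1..n}"
  shows "h_map n d j \<rho> x y = (if (x 1 + y j) mod d = (x j + y 1) mod d then \<rho> x y else 0)"
proof -
  let ?B = "basis d {1..n}"
  have fin: "finite ?B"
    by (simp add: finite_basis)
  have one: "1 \<in> {1..n}"
    using j by auto
  \<comment> \<open>The phase exponent \<open>x 1 - x j - y 1 + y j\<close>, an integer that may be
    negative.\<close>
  define m where "m = int (x 1 + y j) - int (x j + y 1)"
  have "op_mult ?B (op_mult ?B (op_mult ?B (op_mult ?B Z1 (Defs.adjoint Zj)) \<rho>) (Defs.adjoint Z1)) Zj x y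
      = exp (2 * of_real pi * \<i> * of_int m * of_nat k / of_nat d) * \<rho> x y"
    if "Z1 = at_site n 1 (Z_op d k)" and "Zj = at_site n j (Z_op d k)" for k Z1 Zj
  proof -
    let ?w = "\<lambda>r. exp (2 * of_real pi * \<i> * of_nat r * of_nat k / of_nat d)"
    have Z1: "Z1 a b = (if b = a then ?w (a 1) else 0)"
      and Zj: "Zj a b = (if b = a then ?w (a j) else 0)" if "a \<in> ?B" "b \<in> ?B" for a b
      using at_site_Z_op[OF one that] at_site_Z_op[OF j that] \<open>Z1 = _\<close> \<open>Zj = _\<close> by auto
    have Z1': "Defs.adjoint Z1 a b = (if a = b then cnj (?w (b 1)) else 0)"
      and Zj': "Defs.adjoint Zj a b = (if b = a then cnj (?w (a j)) else 0)" if "a \<in> ?B" "b \<in> ?B" for a b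
      using Z1[OF that(2,1)] Zj[OF that(2,1)] by (auto simp: Defs.adjoint_def)
    have "op_mult ?B Z1 (Defs.adjoint Zj) x z = (if z = x then ?w (x 1) * cnj (?w (x j)) else 0)" if "z \<in> ?B" for z
      using that x fin
      by (subst op_mult_diagonal_left[where D = Z1 and f = "?w (x 1)"]) (auto simp: Z1 Zj')
    then have "op_mult ?B (op_mult ?B Z1 (Defs.adjoint Zj)) \<rho> x z = ?w (x 1) * cnj (?w (x j)) * \<rho> x z" for z
      by (rule op_mult_diagonal_left[OF fin x])
    moreover have "op_mult ?B M (Defs.adjoint Z1) x y = M x y * cnj (?w (y 1))" for M
      using y by (intro op_mult_diagonal_right[OF fin y] Z1')
    moreover have "op_mult ?B M Zj x y = M x y * ?w (y j)" for M
      using y by (intro op_mult_diagonal_right[OF fin y]) (auto simp: Zj)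
    ultimately have "op_mult ?B (op_mult ?B (op_mult ?B (op_mult ?B Z1 (Defs.adjoint Zj)) \<rho>) (Defs.adjoint Z1)) Zj x y
        = (?w (x 1) * cnj (?w (x j)) * cnj (?w (y 1)) * ?w (y j)) * \<rho> x y"
      by (simp add: mult_ac)
    also have "?w (x 1) * cnj (?w (x j)) * cnj (?w (y 1)) * ?w (y j)
        = exp (2 * of_real pi * \<i> * of_int m * of_nat k / of_nat d)"
      by (simp add: exp_cnj m_def diff_divide_distrib add_divide_distrib algebra_simps flip: exp_add)
    finally show ?thesis .
  qed
  then have "h_map n d j \<rho> x y
      = 1 / of_nat d * ((\<Sum>k<d. exp (2 * of_real pi * \<i> * of_int m * of_nat k / of_nat d)) * \<rho> x y)"
    by (simp add: h_map_def Let_def sum_distrib_right)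
  also have "\<dots> = (if int d dvd m then \<rho> x y else 0)"
    using assms(1) by (simp add: sum_root_of_unity)
  also have "int d dvd m \<longleftrightarrow> (x 1 + y j) mod d = (x j + y 1) mod d"
    unfolding m_def by (metis mod_eq_dvd_iff of_nat_eq_iff zmod_int)
  finally show ?thesis .
qed

section \<open>The twirl and the orbits of the diagonal rotation\<close>

text \<open>Constancy of \<open>x - y\<close> modulo \<open>d\<close>, written with sums because
  subtraction of naturals truncates.\<close>

definition aligned :: "nat \<Rightarrow> nat \<Rightarrow> label \<Rightarrow> label \<Rightarrow> bool" where
  "aligned n d x y \<longleftrightarrow> (\<forall>j\<in>{1..n}. (x 1 + y j) mod d = (x j + y 1) mod d)"

lemma X_map_eq:
  assumes "d > 0" and x: "x \<in> basis d {1..n}" and y: "y \<in> basis d {1..n}"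
  shows "X_map n d \<rho> x y = (if aligned n d x y then \<rho> x y else 0)"
proof -
  have "foldr (\<circ>) (map (h_map n d) js) id \<rho> x y
      = (if \<forall>j\<in>set js. (x 1 + y j) mod d = (x j + y 1) mod d then \<rho> x y else 0)"
    if "set js \<subseteq> {1..n}" for js
    using that by (induction js) (auto simp: h_map_eq[OF assms(1) _ x y])
  from this[of "[2..<n+1]"] have "X_map n d \<rho> x y
      = (if \<forall>j\<in>{2..<n+1}. (x 1 + y j) mod d = (x j + y 1) mod d then \<rho> x y else 0)"
    unfolding X_map_def set_upt by (rule meta_mp) auto
  also have "(\<forall>j\<in>{2..<n+1}. (x 1 + y j) mod d = (x j + y 1) mod d) \<longleftrightarrow> aligned n d x y"
  proof -
    \<comment> \<open>The condition at \<open>j = 1\<close> is trivial, so starting the composition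
      at \<open>2\<close> loses nothing.\<close>
    have "j = 1 \<or> j \<in> {2..<n+1}" if "j \<in> {1..n}" for j
      using that by auto
    then show ?thesis
      unfolding aligned_def by fastforce
  qed
  finally show ?thesis .
qed

lemma aligned_refl: "aligned n d x x"
  by (simp add: aligned_def add.commute)

text \<open>A constant difference that vanishes at one site vanishes everywhere. This is what makes
  each \<open>\<Lambda>\<close> act as \<open>- id\<close> off the diagonal of a twirled
  operator.\<close>

lemma aligned_eqI:
  assumes "aligned n d x y" and "x \<in> basis d {1..n}" and "y \<in> basis d {1..n}"
    and "i \<in> {1..n}" and "x i = y i"
  shows "x = y"
proof (rule basis_eqI[OF assms(2,3)])
  have one: "1 \<in> {1..n}"
    using assms(4) by auto
  have "(x 1 + y i) mod d = (y 1 + y i) mod d"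
    using assms(1,4,5) by (metis aligned_def add.commute)
  then have 1: "x 1 = y 1"
    using basis_less[OF assms(2) one] basis_less[OF assms(3) one] by (simp add: add_mod_cancel)
  fix j assume j: "j \<in> {1..n}"
  then have "(x j + y 1) mod d = (y j + y 1) mod d"
    using assms(1) 1 by (metis aligned_def add.commute)
  then show "x j = y j"
    using basis_less[OF assms(2) j] basis_less[OF assms(3) j] by (simp add: add_mod_cancel)
qed

lemma bij_betw_rot_aligned:
  assumes "n > 0" and "d > 0" and x: "x \<in> basis d {1..n}"
  shows "bij_betw (\<lambda>s. rot d {1..n} s x) {..<d} {y \<in> basis d {1..n}. aligned n d x y}"
  unfolding bij_betw_def
proof
  have one: "1 \<in> {1..n}"
    using assms(1) by auto
  show "inj_on (\<lambda>s. rot d {1..n} s x) {..<d}"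
  proof (rule inj_onI)
    fix s t assume "s \<in> {..<d}" "t \<in> {..<d}" and eq: "rot d {1..n} s x = rot d {1..n} t x"
    from fun_cong[OF eq, of 1] have "(s + x 1) mod d = (t + x 1) mod d"
      using one by (simp add: rot_def add.commute)
    with \<open>s \<in> _\<close> \<open>t \<in> _\<close> show "s = t"
      by (simp add: add_mod_cancel)
  qed
  show "(\<lambda>s. rot d {1..n} s x) ` {..<d} = {y \<in> basis d {1..n}. aligned n d x y}" (is "?L = ?R")
  proof
    show "?L \<subseteq> ?R"
      using assms by (auto simp: rot_in_basis) (auto simp: aligned_def rot_def mod_simps add_ac)
    show "?R \<subseteq> ?L"
    proof
      fix y assume "y \<in> ?R"
      then have y: "y \<in> basis d {1..n}" "aligned n d x y"
        by auto
      \<comment> \<open>The difference \<open>y 1 - x 1\<close> modulo \<open>d\<close>;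
        \<open>d - x 1\<close> stands in for \<open>- x 1\<close>.\<close>
      define s where "s = (y 1 + (d - x 1)) mod d"
      have "y = rot d {1..n} s x"
      proof (rule basis_eqI[OF y(1)])
        show "rot d {1..n} s x \<in> basis d {1..n}"
          using assms by (auto intro: rot_in_basis)
        fix j assume j: "j \<in> {1..n}"
        have "x 1 < d"
          using x one by (rule basis_less)
        have "(x j + s) mod d = (x j + y 1 + (d - x 1)) mod d"
          by (simp add: s_def mod_simps add.assoc)
        also have "\<dots> = (x 1 + y j + (d - x 1)) mod d"
          using y(2) j by (simp add: aligned_def add_mod_cancel)
        also have "x 1 + y j + (d - x 1) = y j + d"
          using \<open>x 1 < d\<close> by simp
        also have "(y j + d) mod d = y j"
          using basis_less[OF y(1) j] by simp
        finally show "y j = rot d {1..n} s x j"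
          using j by (simp add: rot_def)
      qed
      then show "y \<in> ?L"
        using assms(2) by (auto simp: s_def)
    qed
  qed
qed

text \<open>The hypothesis concerns the restriction of \<open>Q\<close> to every orbit of the diagonal rotation, each
  of which is visited \<open>d\<close> times when \<open>x\<close> runs through the basis.\<close>

lemma psd_aligned:
  assumes "n > 0" and "d > 0"
    and block: "\<And>x. x \<in> basis d {1..n} \<Longrightarrow>
      psd {..<d} (\<lambda>s t. Q (rot d {1..n} s x) (rot d {1..n} t x))"
    and supp: "\<And>x y. x \<in> basis d {1..n} \<Longrightarrow> y \<in> basis d {1..n} \<Longrightarrow> \<not> aligned n d x y \<Longrightarrow> Q x y = 0"
  shows "psd (basis d {1..n}) Q"
  unfolding psd_iff_qform
proof
  fix v
  let ?B = "basis d {1..n}" and ?r = "rot d {1..n}"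
  define f where "f = (\<lambda>x y. cnj (v x) * Q x y * v y)"
  have fin: "finite ?B"
    by (simp add: finite_basis)
  have "(\<Sum>y\<in>?B. f x y) = (\<Sum>s<d. f x (?r s x))" if "x \<in> ?B" for x
  proof -
    have "(\<Sum>y\<in>?B. f x y) = (\<Sum>y\<in>{y \<in> ?B. aligned n d x y}. f x y)"
      using fin that by (intro sum.mono_neutral_right) (auto simp: f_def supp)
    also have "\<dots> = (\<Sum>s<d. f x (?r s x))"
      by (rule sum.reindex_bij_betw[OF bij_betw_rot_aligned[OF assms(1,2) that], symmetric])
    finally show ?thesis .
  qed
  then have q: "qform ?B Q v = (\<Sum>x\<in>?B. \<Sum>s<d. f x (?r s x))"
    by (simp add: qform_def f_def)
  \<comment> \<open>Rotation by \<open>t\<close> permutes the basis and the inner sum runs over a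
    whole orbit, so the value is unchanged; summing over \<open>t\<close> then completes the block
    of each orbit.\<close>
  have "qform ?B Q v = (\<Sum>x\<in>?B. \<Sum>s<d. f (?r t x) (?r s x))" for t
  proof -
    have "qform ?B Q v = (\<Sum>x\<in>?B. \<Sum>s<d. f (?r t x) (?r s (?r t x)))"
      unfolding q using assms(2)
      by (intro sum.reindex_bij_betw[OF bij_betw_rot, symmetric]) auto
    also have "\<dots> = (\<Sum>x\<in>?B. \<Sum>s<d. f (?r t x) (?r ((s + t) mod d) x))"
      by (simp add: rot_rot rot_mod add.commute)
    also have "\<dots> = (\<Sum>x\<in>?B. \<Sum>s<d. f (?r t x) (?r s x))"
      using sum_add_mod[OF assms(2), of "\<lambda>s. f (?r t x) (?r s x)" t for x] by simp
    finally show ?thesis .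
  qed
  then have "of_nat d * qform ?B Q v = (\<Sum>t<d. \<Sum>x\<in>?B. \<Sum>s<d. f (?r t x) (?r s x))"
    by simp
  also have "\<dots> = (\<Sum>x\<in>?B. \<Sum>t<d. \<Sum>s<d. f (?r t x) (?r s x))"
    by (rule sum.swap)
  also have "\<dots> = (\<Sum>x\<in>?B. qform {..<d} (\<lambda>s t. Q (?r s x) (?r t x)) (\<lambda>s. v (?r s x)))"
    by (simp add: f_def qform_def)
  also have "\<dots> \<in> \<real>\<^sub>\<ge>\<^sub>0"
    using block by (intro nonneg_Reals_sum) (simp add: psd_iff_qform)
  finally have "of_nat d * qform ?B Q v / of_nat d \<in> \<real>\<^sub>\<ge>\<^sub>0"
    by (rule nonneg_Reals_divide_I) simp
  then show "qform ?B Q v \<in> \<real>\<^sub>\<ge>\<^sub>0"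
    using assms(2) by simp
qed

section \<open>Biseparable states\<close>

definition shifted_diag :: "nat \<Rightarrow> nat set \<Rightarrow> label op \<Rightarrow> label \<Rightarrow> complex" where
  "shifted_diag d A r x = (\<Sum>j\<in>{1..d-2}. r (rot d A j x) (rot d A j x))"

text \<open>The entries of \<open>\<Lambda>\<close> on \<open>A\<close>, tensored with the identity
  and applied to the twirled operator, once alignment has removed the terms with
  \<open>x \<noteq> y\<close> from its diagonal part.\<close>

definition choi_aligned :: "nat \<Rightarrow> nat \<Rightarrow> nat set \<Rightarrow> label op \<Rightarrow> label op" where
  "choi_aligned n d A r x y =
     (if x = y then 2 * r x x + shifted_diag d A r x else 0) - (if aligned n d x y then r x y else 0)"

text \<open>On an orbit of the diagonal rotation, the image of a product operator is the Hadamard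
  product of the Choi map of \<open>\<sigma>\<close> and \<open>\<tau>\<close>, both compressed to the orbit.\<close>

lemma psd_choi_aligned_tensor:
  assumes "d \<ge> 2" and "A \<noteq> {}" and "A \<subseteq> {1..n}"
    and "psd (basis d A) \<sigma>" and "psd (basis d ({1..n} - A)) \<tau>"
  shows "psd (basis d {1..n}) (choi_aligned n d A (tensor A ({1..n} - A) \<sigma> \<tau>))"
proof (rule psd_aligned)
  let ?U = "{1..n}"
  let ?C = "?U - A"
  have fA: "finite A"
    using assms(3) by (rule finite_subset) simp
  show n: "n > 0" and d: "d > 0"
    using assms(1-3) by (cases n; auto)+
  show "choi_aligned n d A (tensor A ?C \<sigma> \<tau>) x y = 0" if "\<not> aligned n d x y" for x y
    using that aligned_refl[of n d x] by (auto simp: choi_aligned_def)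
  fix x assume x: "x \<in> basis d ?U"
  let ?r = "\<lambda>s. rot d ?U s x"
  have r: "?r s \<in> basis d ?U" for s
    using x d by (simp add: rot_in_basis)
  define S where "S = (\<lambda>s t. \<sigma> (restrict (?r s) A) (restrict (?r t) A))"
  define T where "T = (\<lambda>s t. \<tau> (restrict (?r s) ?C) (restrict (?r t) ?C))"
  have "psd {..<d} S"
    unfolding S_def using assms(4) finite_basis[OF fA]
    by (rule psd_compress) (intro image_subsetI restrict_in_basis[OF r assms(3)])
  moreover have "psd {..<d} T"
    unfolding T_def using assms(5) finite_basis[of ?C d]
    by (rule psd_compress) (auto intro!: restrict_in_basis[OF r] simp del: One_nat_def)
  ultimately have "psd {..<d} (\<lambda>s t. ((if s = t then 2 * S s s + (\<Sum>j\<in>{1..d-2}. S ((s + j) mod d) ((s + j) mod d)) else 0)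
    - S s t) * T s t)"
    using assms(1) by (intro psd_hadamard psd_choi) auto
  then show "psd {..<d} (\<lambda>s t. choi_aligned n d A (tensor A ?C \<sigma> \<tau>) (?r s) (?r t))"
  proof (rule psd_cong[THEN iffD1, rotated])
    fix s t assume st: "s \<in> {..<d}" "t \<in> {..<d}"
    have eq: "?r s = ?r t \<longleftrightarrow> s = t"
      using bij_betw_imp_inj_on[OF bij_betw_rot_aligned[OF n d x]] st by (auto dest: inj_onD)
    have al: "aligned n d (?r s) (?r t)"
      using n by (simp add: aligned_def rot_def mod_add_eq) (simp add: add_ac)
    \<comment> \<open>Rotating only \<open>A\<close> advances the argument of
      \<open>\<sigma>\<close> from \<open>s\<close> to \<open>s + j\<close> and leaves that of
      \<open>\<tau>\<close> at \<open>s\<close>, so \<open>T s s\<close> factors out of the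
      sum.\<close>
    have "restrict (rot d A j (?r s)) A = restrict (?r ((s + j) mod d)) A"
      and "restrict (rot d A j (?r s)) ?C = restrict (?r s) ?C" for j
      using assms(3) by (auto simp: rot_def restrict_def fun_eq_iff mod_simps add_ac)
    then have shifted: "shifted_diag d A (tensor A ?C \<sigma> \<tau>) (?r s) = (\<Sum>j\<in>{1..d-2}. S ((s + j) mod d) ((s + j) mod d)) * T s s"
      by (simp add: shifted_diag_def tensor_def S_def T_def sum_distrib_right)
    have tensor: "tensor A ?C \<sigma> \<tau> (?r s) (?r t) = S s t * T s t" for s t
      by (simp add: tensor_def S_def T_def)
    show "((if s = t then 2 * S s s + (\<Sum>j\<in>{1..d-2}. S ((s + j) mod d) ((s + j) mod d)) else 0)
        - S s t) * T s t = choi_aligned n d A (tensor A ?C \<sigma> \<tau>) (?r s) (?r t)"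
      unfolding choi_aligned_def eq shifted tensor using al by (simp add: algebra_simps)
  qed
qed

lemma tensor_commute: "tensor A C \<sigma> \<tau> = tensor C A \<tau> \<sigma>"
  by (simp add: tensor_def fun_eq_iff)

section \<open>Bipartitions and their number\<close>

lemma bipartition_parts:
  assumes "P \<in> bipartitions n" and "A \<in> P"
  shows "P = {A, {1..n} - A}" and "A \<noteq> {}" and "A \<subset> {1..n}"
proof -
  have part: "partition_on {1..n} P" and "card P = 2"
    using assms(1) by (auto simp: bipartitions_def)
  then obtain C where C: "P = {A, C}" "A \<noteq> C"
    using assms(2) by (auto simp: card_2_iff doubleton_eq_iff)
  have "A \<union> C = {1..n}" "A \<inter> C = {}" "A \<noteq> {}" "C \<noteq> {}"
    using part C by (auto simp: partition_on_def disjoint_def)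
  then show "P = {A, {1..n} - A}" "A \<noteq> {}" "A \<subset> {1..n}"
    using C(1) by auto
qed

lemma bipartitionI:
  assumes "A \<noteq> {}" and "A \<subset> {1..n}"
  shows "{A, {1..n} - A} \<in> bipartitions n"
proof -
  have "A \<noteq> {1..n} - A"
    using assms(1) by auto
  then show ?thesis
    using assms by (auto simp: bipartitions_def partition_on_def disjoint_def)
qed

text \<open>A bipartition is determined by the part without site \<open>1\<close>, a nonempty subset
  of \<open>{2..n}\<close>.\<close>

lemma bipartitions_finite_card:
  assumes "n > 0"
  shows "finite (bipartitions n)" and "card (bipartitions n) \<le> 2 ^ (n - 1) - 1"
proof -
  let ?F = "Pow {2..n} - {{}}" and ?f = "\<lambda>A. {A, {1..n} - A}"
  have fin: "finite ?F"
    by simp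
  have sub: "bipartitions n \<subseteq> ?f ` ?F"
  proof
    fix P assume P: "P \<in> bipartitions n"
    then have "\<Union>P = {1..n}"
      by (simp add: bipartitions_def partition_on_def)
    then have "1 \<in> \<Union>P"
      using assms by auto
    then obtain C where C: "C \<in> P" "1 \<in> C"
      by blast
    note parts = bipartition_parts[OF P C(1)]
    define A where "A = {1..n} - C"
    have "A \<in> P"
      using parts(1) A_def by blast
    from bipartition_parts[OF P this] have "P = ?f A" "A \<noteq> {}"
      by auto
    moreover have "A \<subseteq> {2..n}"
    proof
      fix i assume "i \<in> A"
      with C(2) have "i \<in> {1..n}" "i \<noteq> 1"
        by (auto simp: A_def)
      then show "i \<in> {2..n}"
        by auto
    qed
    ultimately show "P \<in> ?f ` ?F"
      by blast
  qed
  then show "finite (bipartitions n)"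
    using fin by (auto intro: finite_subset)
  have "card (bipartitions n) \<le> card (?f ` ?F)"
    using sub fin by (intro card_mono) auto
  also have "\<dots> \<le> card ?F"
    using fin by (rule card_image_le)
  also have "\<dots> = 2 ^ (n - 1) - 1"
    by (simp add: card_Diff_singleton card_Pow numeral_2_eq_2)
  finally show "card (bipartitions n) \<le> 2 ^ (n - 1) - 1" .
qed

section \<open>The twirled map in coordinates and its positivity\<close>

definition mu_aligned :: "nat \<Rightarrow> nat \<Rightarrow> (nat set set \<Rightarrow> nat set) \<Rightarrow> label op \<Rightarrow> label op" where
  "mu_aligned n d c r x y =
     (if x = y then 2 * of_nat (card (bipartitions n)) * r x x
        + (2 ^ (n - 1) - 1) * (\<Sum>P\<in>bipartitions n. shifted_diag d (c P) r x) else 0)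
     - of_nat (card (bipartitions n)) * (if aligned n d x y then r x y else 0)"

lemma mu_map_X_map:
  assumes "d > 0" and c: "\<And>P. P \<in> bipartitions n \<Longrightarrow> c P \<in> P"
    and x: "x \<in> basis d {1..n}" and y: "y \<in> basis d {1..n}"
  shows "mu_map n d c (X_map n d \<rho>) x y = mu_aligned n d c \<rho> x y"
proof -
  let ?U = "{1..n}"
  have "tensor_id (c P) (choi_map d (c P)) (X_map n d \<rho>) x y = choi_aligned n d (c P) \<rho> x y"
    if "P \<in> bipartitions n" for P
  proof -
    note parts = bipartition_parts[OF that c[OF that]]
    then have sub: "c P \<subseteq> ?U"
      by auto
    have X: "X_map n d \<rho> (rot d (c P) j x) (rot d (c P) j y)
        = (if aligned n d (rot d (c P) j x) (rot d (c P) j y) then \<rho> (rot d (c P) j x) (rot d (c P) j y) else 0)" for j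
      using x y sub assms(1) by (intro X_map_eq rot_in_basis)
    note eq = tensor_id_choi_map[OF finite_atLeastAtMost sub assms(1) x y, of "X_map n d \<rho>", unfolded X X_map_eq[OF assms(1) x y]]
    show ?thesis
    proof (cases "x = y")
      case True
      then show ?thesis
        unfolding eq by (simp add: choi_aligned_def shifted_diag_def aligned_refl)
    next
      case False
      \<comment> \<open>Rotating both labels on the part preserves agreement there, so alignment
        would make the rotated labels equal, and hence \<open>x = y\<close>.\<close>
      have "\<not> aligned n d (rot d (c P) j x) (rot d (c P) j y)"
        if agree: "\<forall>i\<in>c P. x i = y i" for j
      proof
        obtain i where i: "i \<in> c P"
          using parts(2) by auto
        assume "aligned n d (rot d (c P) j x) (rot d (c P) j y)"
        then have "rot d (c P) j x = rot d (c P) j y"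
          using i sub x y assms(1) agree
          by (intro aligned_eqI[where i = i]) (auto simp: rot_in_basis, simp add: rot_def)
        then show False
          using rot_eq_iff[OF x y sub] False by simp
      qed
      moreover have "\<not> aligned n d x y" if agree: "\<forall>i\<in>c P. x i = y i"
        using parts(2) sub agree False aligned_eqI[OF _ x y] by blast
      ultimately show ?thesis
        using False by (auto simp: eq choi_aligned_def)
    qed
  qed
  then have phi: "phi_map n d c (X_map n d \<rho>) x y = (\<Sum>P\<in>bipartitions n. choi_aligned n d (c P) \<rho> x y)"
    by (simp add: phi_map_def)
  show ?thesis
  proof (cases "x = y")
    case True
    \<comment> \<open>\<open>mu_map\<close> subtracts the multiple of \<open>\<rho> x x\<close> from
      its extra copies of this diagonal, so only the shifted sums are amplified, to the factor
      \<open>2 ^ (n - 1) - 1\<close>.\<close>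
    then have "phi_map n d c (X_map n d \<rho>) x y
        = of_nat (card (bipartitions n)) * \<rho> x x + (\<Sum>P\<in>bipartitions n. shifted_diag d (c P) \<rho> x)"
      unfolding phi by (simp add: choi_aligned_def aligned_refl sum.distrib)
    with True show ?thesis
      using X_map_eq[OF assms(1) x x, of \<rho>]
      by (simp add: mu_map_def mu_aligned_def diag_part_def aligned_refl algebra_simps)
  next
    case False
    then show ?thesis
      by (simp add: mu_map_def mu_aligned_def diag_part_def phi choi_aligned_def sum_negf)
  qed
qed

lemma psd_mu_aligned_tensor:
  assumes "d \<ge> 2" and c: "\<And>P. P \<in> bipartitions n \<Longrightarrow> c P \<in> P"
    and A: "A \<noteq> {}" "A \<subset> {1..n}"
    and \<sigma>: "psd (basis d A) \<sigma>" and \<tau>: "psd (basis d ({1..n} - A)) \<tau>"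
  shows "psd (basis d {1..n}) (mu_aligned n d c (tensor A ({1..n} - A) \<sigma> \<tau>))"
proof -
  let ?U = "{1..n}" and ?P = "{A, {1..n} - A}"
  let ?B = "basis d ?U" and ?r = "tensor A (?U - A) \<sigma> \<tau>" and ?N = "card (bipartitions n)"
  have n: "n > 0"
    using A by (cases n) auto
  note bip = bipartitions_finite_card[OF n]
  have P: "?P \<in> bipartitions n"
    using A by (rule bipartitionI)
  have block: "psd ?B (choi_aligned n d (c ?P) ?r)"
  proof -
    \<comment> \<open>The part chosen by \<open>c\<close> may be the complement of \<open>A\<close>;
      the two factors then trade places.\<close>
    have "?U - (?U - A) = A"
      using A by auto
    then have "psd ?B (choi_aligned n d (?U - A) ?r)"
      using psd_choi_aligned_tensor[OF assms(1), of "?U - A" n \<tau> \<sigma>] A \<sigma> \<tau>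
      by (auto simp: tensor_commute[of A])
    moreover have "psd ?B (choi_aligned n d A ?r)"
      using assms(1) A \<sigma> \<tau> by (intro psd_choi_aligned_tensor) auto
    ultimately show ?thesis
      using c[OF P] by auto
  qed
  have fA: "finite A"
    using A(2) by (auto intro: finite_subset)
  have "?r x x \<in> \<real>\<^sub>\<ge>\<^sub>0" if "x \<in> ?B" for x
    unfolding tensor_def using that A fA
    by (intro nonneg_Reals_mult_I psd_diag_nonneg[OF \<sigma>] psd_diag_nonneg[OF \<tau>])
       (auto intro: finite_basis restrict_in_basis)
  then have nonneg: "shifted_diag d (c P) ?r x \<in> \<real>\<^sub>\<ge>\<^sub>0" if "x \<in> ?B" "P \<in> bipartitions n" for x P
    unfolding shifted_diag_def using that assms(1) bipartition_parts(3)[OF that(2) c[OF that(2)]]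
    by (intro nonneg_Reals_sum) (auto simp: rot_in_basis)
  define K :: complex where "K = 2 ^ (n - 1) - 1"
  have K: "K = of_nat (2 ^ (n - 1) - 1)"
    by (simp add: K_def of_nat_diff)
  then have K_nonneg: "K \<in> \<real>\<^sub>\<ge>\<^sub>0"
    by (simp only: nonneg_Reals_of_nat_I)
  from K have K': "K - of_nat ?N \<in> \<real>\<^sub>\<ge>\<^sub>0"
    using bip(2) by (simp flip: of_nat_diff)
  \<comment> \<open>What remains on the diagonal after \<open>?N\<close> copies of the positive
    block of \<open>?P\<close> are split off; \<open>?N \<le> K\<close> keeps the last coefficient
    nonnegative.\<close>
  define h where "h = (\<lambda>x. K * (\<Sum>P\<in>bipartitions n - {?P}. shifted_diag d (c P) ?r x)
    + (K - of_nat ?N) * shifted_diag d (c ?P) ?r x)"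
  have "psd ?B (\<lambda>x y. of_nat ?N * choi_aligned n d (c ?P) ?r x y + (if x = y then h x else 0))"
  proof (intro psd_add psd_scale block psd_diagonal)
    fix x assume "x \<in> ?B"
    then show "h x \<in> \<real>\<^sub>\<ge>\<^sub>0"
      unfolding h_def using P K_nonneg K' nonneg
      by (intro nonneg_Reals_add_I nonneg_Reals_mult_I nonneg_Reals_sum) auto
  qed (simp_all add: finite_basis)
  then show ?thesis
  proof (rule psd_cong[THEN iffD1, rotated])
    fix x y
    have sum_eq: "(\<Sum>P\<in>bipartitions n. shifted_diag d (c P) ?r x)
        = shifted_diag d (c ?P) ?r x + (\<Sum>P\<in>bipartitions n - {?P}. shifted_diag d (c P) ?r x)"
      using bip(1) P by (rule sum.remove)
    show "of_nat ?N * choi_aligned n d (c ?P) ?r x y + (if x = y then h x else 0) = mu_aligned n d c ?r x y"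
      unfolding mu_aligned_def choi_aligned_def h_def K_def[symmetric] sum_eq
      by (simp add: algebra_simps)
  qed
qed

text \<open>Linearity, for a decomposition known only at labels in the basis; the rotated labels
  stay there.\<close>

lemma mu_aligned_sum:
  assumes "d > 0" and c: "\<And>P. P \<in> bipartitions n \<Longrightarrow> c P \<in> P"
    and \<rho>: "\<And>x y. x \<in> basis d {1..n} \<Longrightarrow> y \<in> basis d {1..n} \<Longrightarrow> \<rho> x y = (\<Sum>i\<in>I. p i * r i x y)"
    and x: "x \<in> basis d {1..n}" and y: "y \<in> basis d {1..n}"
  shows "mu_aligned n d c \<rho> x y = (\<Sum>i\<in>I. p i * mu_aligned n d c (r i) x y)"
proof -
  have "shifted_diag d (c P) \<rho> x = (\<Sum>i\<in>I. p i * shifted_diag d (c P) (r i) x)"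
    if "P \<in> bipartitions n" for P
  proof -
    have "rot d (c P) j x \<in> basis d {1..n}" for j
      using x assms(1) bipartition_parts(3)[OF that c[OF that]] by (auto intro: rot_in_basis)
    then show ?thesis
      unfolding shifted_diag_def by (subst sum_distrib_left, subst sum.swap) (simp add: \<rho>)
  qed
  then have "(\<Sum>P\<in>bipartitions n. shifted_diag d (c P) \<rho> x)
      = (\<Sum>i\<in>I. p i * (\<Sum>P\<in>bipartitions n. shifted_diag d (c P) (r i) x))"
    by (subst sum_distrib_left, subst sum.swap) simp
  with x y show ?thesis
    by (cases "x = y")
       (simp_all add: mu_aligned_def \<rho> sum_distrib_left sum.distrib sum_subtractf sum_negf algebra_simps)
qed

theorem theorem9:
  fixes n d :: nat
    and c :: "nat set set \<Rightarrow> nat set"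
    and \<rho> :: "label op"
  assumes "n \<ge> 2" and "d \<ge> 2"
    and "\<And>P. P \<in> bipartitions n \<Longrightarrow> c P \<in> P"
    and "biseparable n d \<rho>"
  shows "psd (basis d {1..n}) ((mu_map n d c \<circ> X_map n d) \<rho>)"
proof -
  let ?B = "basis d {1..n}"
  have d: "d > 0"
    using assms(2) by simp
  obtain m :: nat and p :: "nat \<Rightarrow> real" and A :: "nat \<Rightarrow> nat set" and \<sigma> \<tau> :: "nat \<Rightarrow> label op" where
    p: "\<forall>i<m. 0 \<le> p i"
    and parts: "\<forall>i<m. A i \<noteq> {} \<and> A i \<subset> {1..n} \<and>
      is_state (basis d (A i)) (\<sigma> i) \<and> is_state (basis d ({1..n} - A i)) (\<tau> i)"
    and \<rho>: "\<forall>x\<in>?B. \<forall>y\<in>?B.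
      \<rho> x y = (\<Sum>i<m. complex_of_real (p i) * tensor (A i) ({1..n} - A i) (\<sigma> i) (\<tau> i) x y)"
    using assms(4) unfolding biseparable_def by blast
  let ?r = "\<lambda>i. tensor (A i) ({1..n} - A i) (\<sigma> i) (\<tau> i)"
  \<comment> \<open>Each product term is handled with its own bipartition, and the weights
    \<open>p i\<close> are nonnegative.\<close>
  have "psd ?B (\<lambda>x y. \<Sum>i<m. complex_of_real (p i) * mu_aligned n d c (?r i) x y)"
    using p parts assms(2,3)
    by (intro psd_sum psd_scale psd_mu_aligned_tensor) (auto simp: is_state_def)
  then show ?thesis
  proof (rule psd_cong[THEN iffD1, rotated])
    fix x y assume xy: "x \<in> ?B" "y \<in> ?B"
    have "mu_aligned n d c \<rho> x y = (\<Sum>i<m. complex_of_real (p i) * mu_aligned n d c (?r i) x y)"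
      using \<rho> xy by (intro mu_aligned_sum d assms(3)) auto
    then show "(\<Sum>i<m. complex_of_real (p i) * mu_aligned n d c (?r i) x y) = (mu_map n d c \<circ> X_map n d) \<rho> x y"
      using mu_map_X_map[OF d assms(3) xy] by simp
  qed
qed

end
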